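(* Let $R$ be a ring with unity, let $\mathcal{X}$ be a semibrick of left $R$-modules, let $N$ be a module with an $\mathcal{X}$-filtration, and let $M$ be an $\mathcal{X}$-semisimple module. For any homomorphism $f\in\mathrm{Hom}(N,M)$, the image of $f$ is an $\mathcal{X}$-semisimple submodule and a direct summand of $M$.
   Context: A brick is a finitely presented left $R$-module whose endomorphism ring is a division ring. A semibrick is a class $\mathcal{X}$ of pairwise non-isomorphic bricks with $\mathrm{Hom}(X,X')=0$ for distinct $X,X'\in\mathcal{X}$. A filtration of a module $N$ is an ascending chain $(N_\lambda,\lambda\le\mu)$ of submodules ($\mu$ an ordinal) with $N_0=0$, $N_\mu=N$ and $N_\nu=\bigcup_{\lambda<\nu}N_\lambda$ for limit ordinals $\nu\le\mu$. It is an $\mathcal{X}$-filtration if each $N_{\lambda+1}/N_\lambda$ ($\lambda<\mu$) is isomorphic to a module in $\mathcal{X}$. A module is $\mathcal{X}$-semisimple if it is isomorphic to a (possibly empty or infinite) direct sum of objects from $\mathcal{X}$ (repetitions allowed). *)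

theory Defs
  imports "HOL-Algebra.Module" "HOL-Algebra.AbelCoset" "HOL-Library.FuncSet"
begin

text \<open>
  The library locale \<open>module\<close> asks for a commutative ring of scalars. Below, the same
  axioms are imposed over an arbitrary unital ring. The record type of the library is kept; its
  multiplicative fields play no role for modules, so they are left \<open>undefined\<close> in the
  constructions.
\<close>

locale left_module = R?: ring R + M?: abelian_group M for R (structure) and M (structure) +
  assumes smult_closed [simp, intro]:
      "\<lbrakk>a \<in> carrier R; x \<in> carrier M\<rbrakk> \<Longrightarrow> a \<odot>\<^bsub>M\<^esub> x \<in> carrier M"
    and smult_l_distr:
      "\<lbrakk>a \<in> carrier R; b \<in> carrier R; x \<in> carrier M\<rbrakk> \<Longrightarrow>
        (a \<oplus> b) \<odot>\<^bsub>M\<^esub> x = a \<odot>\<^bsub>M\<^esub> x \<oplus>\<^bsub>M\<^esub> b \<odot>\<^bsub>M\<^esub> x"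
    and smult_r_distr:
      "\<lbrakk>a \<in> carrier R; x \<in> carrier M; y \<in> carrier M\<rbrakk> \<Longrightarrow>
        a \<odot>\<^bsub>M\<^esub> (x \<oplus>\<^bsub>M\<^esub> y) = a \<odot>\<^bsub>M\<^esub> x \<oplus>\<^bsub>M\<^esub> a \<odot>\<^bsub>M\<^esub> y"
    and smult_assoc1:
      "\<lbrakk>a \<in> carrier R; b \<in> carrier R; x \<in> carrier M\<rbrakk> \<Longrightarrow>
        (a \<otimes> b) \<odot>\<^bsub>M\<^esub> x = a \<odot>\<^bsub>M\<^esub> (b \<odot>\<^bsub>M\<^esub> x)"
    and smult_one [simp]: "x \<in> carrier M \<Longrightarrow> \<one> \<odot>\<^bsub>M\<^esub> x = x"

definition restrict_module :: "('r, 'm) module \<Rightarrow> 'm set \<Rightarrow> ('r, 'm) module" where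
  "restrict_module M H = M\<lparr>carrier := H\<rparr>"

definition direct_summand :: "('r, 'c) ring_scheme \<Rightarrow> ('r, 'm) module \<Rightarrow> 'm set \<Rightarrow> bool" where
  "direct_summand R M H \<longleftrightarrow>
     submodule H R M \<and>
     (\<exists>K. submodule K R M \<and> H <+>\<^bsub>M\<^esub> K = carrier M \<and> H \<inter> K = {\<zero>\<^bsub>M\<^esub>})"

definition quotient_module :: "('r, 'm) module \<Rightarrow> 'm set \<Rightarrow> ('r, 'm set) module" where
  "quotient_module M H =
     \<lparr>carrier = a_rcosets\<^bsub>M\<^esub> H, monoid.mult = undefined, one = undefined,
      zero = H, add = (<+>\<^bsub>M\<^esub>),
      smult = (\<lambda>a C. \<Union>x\<in>C. H +>\<^bsub>M\<^esub> (a \<odot>\<^bsub>M\<^esub> x))\<rparr>"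

definition Hom :: "('r, 'c) ring_scheme \<Rightarrow> ('r, 'm) module \<Rightarrow> ('r, 'n) module \<Rightarrow> ('m \<Rightarrow> 'n) set"
  where
  "Hom R M N =
     {f \<in> carrier M \<rightarrow> carrier N.
       (\<forall>x\<in>carrier M. \<forall>y\<in>carrier M. f (x \<oplus>\<^bsub>M\<^esub> y) = f x \<oplus>\<^bsub>N\<^esub> f y) \<and>
       (\<forall>a\<in>carrier R. \<forall>x\<in>carrier M. f (a \<odot>\<^bsub>M\<^esub> x) = a \<odot>\<^bsub>N\<^esub> f x)}"

definition isomorphic :: "('r, 'c) ring_scheme \<Rightarrow> ('r, 'm) module \<Rightarrow> ('r, 'n) module \<Rightarrow> bool"
  where
  "isomorphic R M N \<longleftrightarrow> (\<exists>f\<in>Hom R M N. bij_betw f (carrier M) (carrier N))"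

text \<open>Functions are made extensional so that equal endomorphisms are equal elements of
  \<open>End_ring\<close>.\<close>

definition End_ring :: "('r, 'c) ring_scheme \<Rightarrow> ('r, 'm) module \<Rightarrow> ('m \<Rightarrow> 'm) ring" where
  "End_ring R M =
     \<lparr>carrier = Hom R M M \<inter> extensional (carrier M),
      monoid.mult = compose (carrier M), one = (\<lambda>x\<in>carrier M. x),
      zero = (\<lambda>x\<in>carrier M. \<zero>\<^bsub>M\<^esub>), add = (\<lambda>f g. \<lambda>x\<in>carrier M. f x \<oplus>\<^bsub>M\<^esub> g x)\<rparr>"

definition is_division_ring :: "('d, 'c) ring_scheme \<Rightarrow> bool" where
  "is_division_ring D \<longleftrightarrow>
     ring D \<and> \<one>\<^bsub>D\<^esub> \<noteq> \<zero>\<^bsub>D\<^esub> \<and> Units D = carrier D - {\<zero>\<^bsub>D\<^esub>}"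

definition direct_sum :: "'i set \<Rightarrow> ('i \<Rightarrow> ('r, 'm) module) \<Rightarrow> ('r, 'i \<Rightarrow> 'm) module" where
  "direct_sum I F =
     \<lparr>carrier = {x \<in> (\<Pi>\<^sub>E i\<in>I. carrier (F i)). finite {i \<in> I. x i \<noteq> \<zero>\<^bsub>F i\<^esub>}},
      monoid.mult = undefined, one = undefined,
      zero = (\<lambda>i\<in>I. \<zero>\<^bsub>F i\<^esub>), add = (\<lambda>x y. \<lambda>i\<in>I. x i \<oplus>\<^bsub>F i\<^esub> y i),
      smult = (\<lambda>a x. \<lambda>i\<in>I. a \<odot>\<^bsub>F i\<^esub> x i)\<rparr>"

definition regular_module :: "('r, 'c) ring_scheme \<Rightarrow> ('r, 'r) module" where
  "regular_module R =
     \<lparr>carrier = carrier R, monoid.mult = undefined, one = undefined,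
      zero = \<zero>\<^bsub>R\<^esub>, add = (\<oplus>\<^bsub>R\<^esub>), smult = (\<otimes>\<^bsub>R\<^esub>)\<rparr>"

definition free_module :: "('r, 'c) ring_scheme \<Rightarrow> nat \<Rightarrow> ('r, nat \<Rightarrow> 'r) module" where
  "free_module R n = direct_sum {..<n} (\<lambda>_. regular_module R)"

text \<open>There is an exact sequence of the form \<open>R\<^sup>m \<rightarrow> R\<^sup>n \<rightarrow> M \<rightarrow> 0\<close>.\<close>

definition finitely_presented :: "('r, 'c) ring_scheme \<Rightarrow> ('r, 'm) module \<Rightarrow> bool" where
  "finitely_presented R M \<longleftrightarrow>
     (\<exists>m n. \<exists>f\<in>Hom R (free_module R m) (free_module R n). \<exists>g\<in>Hom R (free_module R n) M.
        f ` carrier (free_module R m) = {v \<in> carrier (free_module R n). g v = \<zero>\<^bsub>M\<^esub>} \<and>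
        g ` carrier (free_module R n) = carrier M)"

definition brick :: "('r, 'c) ring_scheme \<Rightarrow> ('r, 'm) module \<Rightarrow> bool" where
  "brick R B \<longleftrightarrow> left_module R B \<and> finitely_presented R B \<and> is_division_ring (End_ring R B)"

definition semibrick :: "('r, 'c) ring_scheme \<Rightarrow> ('r, 'x) module set \<Rightarrow> bool" where
  "semibrick R \<X> \<longleftrightarrow>
     (\<forall>X\<in>\<X>. brick R X) \<and>
     (\<forall>X\<in>\<X>. \<forall>X'\<in>\<X>. X \<noteq> X' \<longrightarrow>
        \<not> isomorphic R X X' \<and> (\<forall>f\<in>Hom R X X'. \<forall>x\<in>carrier X. f x = \<zero>\<^bsub>X'\<^esub>))"

text \<open>
  The direct sum is indexed by a subset of the type of elements of \<open>M\<close>, because HOL cannot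
  quantify over the index type. This is no restriction when the modules in \<open>\<X>\<close> are nonzero,
  as bricks are: see \<open>X_semisimpleI\<close> below.
\<close>

definition X_semisimple ::
  "('r, 'c) ring_scheme \<Rightarrow> ('r, 'x) module set \<Rightarrow> ('r, 'm) module \<Rightarrow> bool" where
  "X_semisimple R \<X> M \<longleftrightarrow>
     (\<exists>(I :: 'm set) F. (\<forall>i\<in>I. F i \<in> \<X>) \<and> isomorphic R M (direct_sum I F))"

text \<open>
  An ordinal \<open>\<mu>\<close> is rendered as an element of a well-ordered type; the ordinals
  \<open>\<kappa> \<le> \<mu>\<close> are the elements of \<open>{..\<mu>}\<close>. A type of class \<open>wellorder\<close> is not
  empty, so it has a least element, and \<open>ord_suc \<kappa>\<close> is only used for \<open>\<kappa> < \<mu>\<close>.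
\<close>

definition ord_zero :: "'o::wellorder" where
  "ord_zero = (LEAST \<kappa>. True)"

definition ord_suc :: "'o::wellorder \<Rightarrow> 'o" where
  "ord_suc \<kappa> = (LEAST \<nu>. \<kappa> < \<nu>)"

definition ord_limit :: "'o::wellorder \<Rightarrow> bool" where
  "ord_limit \<nu> \<longleftrightarrow> \<nu> \<noteq> ord_zero \<and> (\<forall>\<kappa><\<nu>. ord_suc \<kappa> \<noteq> \<nu>)"

definition filtration ::
  "('r, 'c) ring_scheme \<Rightarrow> ('r, 'n) module \<Rightarrow> 'o::wellorder \<Rightarrow> ('o \<Rightarrow> 'n set) \<Rightarrow> bool" where
  "filtration R N \<mu> Nc \<longleftrightarrow>
     (\<forall>\<kappa>\<le>\<mu>. submodule (Nc \<kappa>) R N) \<and>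
     (\<forall>\<kappa> \<nu>. \<kappa> \<le> \<nu> \<and> \<nu> \<le> \<mu> \<longrightarrow> Nc \<kappa> \<subseteq> Nc \<nu>) \<and>
     Nc ord_zero = {\<zero>\<^bsub>N\<^esub>} \<and> Nc \<mu> = carrier N \<and>
     (\<forall>\<nu>\<le>\<mu>. ord_limit \<nu> \<longrightarrow> Nc \<nu> = (\<Union>\<kappa>\<in>{..<\<nu>}. Nc \<kappa>))"

definition X_filtration ::
  "('r, 'c) ring_scheme \<Rightarrow> ('r, 'x) module set \<Rightarrow> ('r, 'n) module \<Rightarrow>
    'o::wellorder \<Rightarrow> ('o \<Rightarrow> 'n set) \<Rightarrow> bool" where
  "X_filtration R \<X> N \<mu> Nc \<longleftrightarrow>
     filtration R N \<mu> Nc \<and>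
     (\<forall>\<kappa><\<mu>. \<exists>X\<in>\<X>.
        isomorphic R (quotient_module (restrict_module N (Nc (ord_suc \<kappa>))) (Nc \<kappa>)) X)"

lemma brick_nonzero:
  assumes "brick R B"
  obtains x where "x \<in> carrier B" "x \<noteq> \<zero>\<^bsub>B\<^esub>"
proof (rule ccontr)
  assume "\<not> thesis"
  then have "(\<lambda>x\<in>carrier B. x) = (\<lambda>x\<in>carrier B. \<zero>\<^bsub>B\<^esub>)"
    using that by (auto intro!: restrict_ext)
  with assms show False
    by (simp add: brick_def is_division_ring_def End_ring_def)
qed

lemma X_semisimpleI:
  fixes I :: "'i set" and F :: "'i \<Rightarrow> ('r, 'x) module" and M :: "('r, 'm) module"
  assumes bricks: "\<And>X. X \<in> \<X> \<Longrightarrow> brick R X"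
    and F: "\<And>i. i \<in> I \<Longrightarrow> F i \<in> \<X>"
    and iso: "isomorphic R M (direct_sum I F)"
  shows "X_semisimple R \<X> M"
proof -
  obtain f where f: "f \<in> Hom R M (direct_sum I F)"
      and bij: "bij_betw f (carrier M) (carrier (direct_sum I F))"
    using iso by (auto simp: isomorphic_def)
  have mod: "left_module R (F i)" if "i \<in> I" for i
    using bricks F that by (auto simp: brick_def)
  have ab: "abelian_group (F i)" if "i \<in> I" for i
    using mod[OF that] by (simp add: left_module_def)
  have zero: "\<zero>\<^bsub>F i\<^esub> \<in> carrier (F i)" if "i \<in> I" for i
    using ab[OF that] by (simp add: abelian_group.axioms(1) abelian_monoid.zero_closed)
  have "\<forall>i\<in>I. \<exists>x. x \<in> carrier (F i) \<and> x \<noteq> \<zero>\<^bsub>F i\<^esub>"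
    using bricks F by (blast elim: brick_nonzero)
  then obtain b where b: "\<And>i. i \<in> I \<Longrightarrow> b i \<in> carrier (F i) \<and> b i \<noteq> \<zero>\<^bsub>F i\<^esub>"
    by metis
  define d where "d i = (\<lambda>j\<in>I. if j = i then b i else \<zero>\<^bsub>F j\<^esub>)" for i
  have d: "d i \<in> carrier (direct_sum I F)" if "i \<in> I" for i
  proof -
    have "{j \<in> I. d i j \<noteq> \<zero>\<^bsub>F j\<^esub>} \<subseteq> {i}"
      by (auto simp: d_def)
    then have "finite {j \<in> I. d i j \<noteq> \<zero>\<^bsub>F j\<^esub>}"
      using finite_subset by blast
    then show ?thesis
      using that b zero by (auto simp: direct_sum_def d_def)
  qed
  have "inj_on d I"
  proof (rule inj_onI)
    fix i j assume "i \<in> I" "j \<in> I" "d i = d j"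
    then have "d i i = d j i" by simp
    then show "i = j"
      using \<open>i \<in> I\<close> b[of i] by (auto simp: d_def split: if_splits)
  qed
  then have "inj_on (inv_into (carrier M) f \<circ> d) I"
    using d bij by (intro comp_inj_on) (auto intro!: inj_on_inv_into simp: bij_betw_def)
  then obtain h :: "'i \<Rightarrow> 'm" where h: "inj_on h I" by blast
  define J where "J = h ` I"
  define k where "k = inv_into I h"
  have kI: "k j \<in> I" if "j \<in> J" for j
    using that by (auto simp: k_def J_def h)
  have hk: "h (k j) = j" if "j \<in> J" for j
    using that by (auto simp: k_def J_def h)
  have kh: "k (h i) = i" if "i \<in> I" for i
    using that by (auto simp: k_def h)
  have hJ: "h i \<in> J" if "i \<in> I" for i
    using that by (auto simp: J_def)
  define G where "G = F \<circ> k"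
  define p where "p x = (\<lambda>j\<in>J. x (k j))" for x :: "'i \<Rightarrow> 'x"
  define q where "q y = (\<lambda>i\<in>I. y (h i))" for y :: "'m \<Rightarrow> 'x"
  have p: "p x \<in> carrier (direct_sum J G)" if "x \<in> carrier (direct_sum I F)" for x
  proof -
    have "{j \<in> J. p x j \<noteq> \<zero>\<^bsub>G j\<^esub>} \<subseteq> h ` {i \<in> I. x i \<noteq> \<zero>\<^bsub>F i\<^esub>}"
      using kI hk by (force simp: p_def G_def)
    moreover have "finite {i \<in> I. x i \<noteq> \<zero>\<^bsub>F i\<^esub>}"
      using that by (simp add: direct_sum_def)
    ultimately have "finite {j \<in> J. p x j \<noteq> \<zero>\<^bsub>G j\<^esub>}"
      using finite_surj by blast
    then show ?thesis
      using that kI by (auto simp: direct_sum_def p_def G_def)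
  qed
  have q: "q y \<in> carrier (direct_sum I F)" if "y \<in> carrier (direct_sum J G)" for y
  proof -
    have "{i \<in> I. q y i \<noteq> \<zero>\<^bsub>F i\<^esub>} \<subseteq> k ` {j \<in> J. y j \<noteq> \<zero>\<^bsub>G j\<^esub>}"
      using kh hJ by (force simp: q_def G_def)
    moreover have "finite {j \<in> J. y j \<noteq> \<zero>\<^bsub>G j\<^esub>}"
      using that by (simp add: direct_sum_def)
    ultimately have "finite {i \<in> I. q y i \<noteq> \<zero>\<^bsub>F i\<^esub>}"
      using finite_surj by blast
    moreover have "y (h i) \<in> carrier (F i)" if "i \<in> I" for i
      using that \<open>y \<in> _\<close> hJ kh PiE_mem[of y J "\<lambda>j. carrier (G j)" "h i"]
      by (simp add: direct_sum_def G_def)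
    ultimately show ?thesis
      by (auto simp: direct_sum_def q_def)
  qed
  have "bij_betw p (carrier (direct_sum I F)) (carrier (direct_sum J G))"
  proof (rule bij_betw_byWitness[where f' = q])
    show "\<forall>x\<in>carrier (direct_sum I F). q (p x) = x"
      by (auto simp: p_def q_def direct_sum_def hJ kh fun_eq_iff PiE_def extensional_def)
    show "\<forall>y\<in>carrier (direct_sum J G). p (q y) = y"
      by (auto simp: p_def q_def direct_sum_def kI hk fun_eq_iff PiE_def extensional_def)
  qed (use p q in auto)
  with bij have "bij_betw (p \<circ> f) (carrier M) (carrier (direct_sum J G))"
    by (rule bij_betw_trans)
  moreover have "p \<circ> f \<in> Hom R M (direct_sum J G)"
  proof -
    have "p (x \<oplus>\<^bsub>direct_sum I F\<^esub> y) = p x \<oplus>\<^bsub>direct_sum J G\<^esub> p y" for x y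
      by (auto simp: p_def direct_sum_def G_def kI)
    moreover have "p (a \<odot>\<^bsub>direct_sum I F\<^esub> x) = a \<odot>\<^bsub>direct_sum J G\<^esub> p x" for a x
      by (auto simp: p_def direct_sum_def G_def kI)
    ultimately show ?thesis
      using f p by (auto simp: Hom_def Pi_iff)
  qed
  ultimately have "isomorphic R M (direct_sum J G)"
    by (auto simp: isomorphic_def)
  moreover have "\<forall>j\<in>J. G j \<in> \<X>"
    using F kI by (simp add: G_def)
  ultimately show ?thesis
    unfolding X_semisimple_def by blast
qed

end

theory Submission
  imports Defs
begin

text \<open>
  Write \<open>M\<close> as a direct sum of bricks \<open>F\<^sub>i\<close>. A homomorphism from a brick of \<open>\<X>\<close> to
  \<open>M\<close> is zero or split injective, because one of its coordinates is invertible. It follows that a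
  finite sum \<open>U\<close> of images of bricks is the kernel of an endomorphism of \<open>M\<close>, so the image of
  a brick meets \<open>U\<close> trivially or lies in it; the same then holds for an arbitrary sum \<open>S\<close> of
  images of bricks. For a set \<open>J\<close> of indices let \<open>F\<^sub>J\<close> be the sum of the \<open>F\<^sub>j\<close> with
  \<open>j \<in> J\<close>. If \<open>J\<close> is maximal with \<open>S \<inter> F\<^sub>J = 0\<close>, then \<open>S + F\<^sub>J\<close> meets, hence
  contains, every \<open>F\<^sub>i\<close>. So \<open>M = S \<oplus> F\<^sub>J\<close>, and \<open>S\<close> is isomorphic to the sum of the
  remaining \<open>F\<^sub>i\<close>.

  Let \<open>S\<close> be the sum of all images of bricks contained in \<open>f N\<close>, and \<open>\<rho>\<close> a projection with
  kernel \<open>S\<close>. Then \<open>\<rho> \<circ> f\<close> vanishes on every step of the filtration: in a successor step it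
  factors through a brick, whose image lies in \<open>f N\<close>, hence in \<open>S\<close>, where \<open>\<rho>\<close> is zero. So
  \<open>f N = S\<close>.
\<close>

section \<open>Homomorphisms and submodules\<close>

lemma HomI:
  assumes "\<And>x. x \<in> carrier M \<Longrightarrow> f x \<in> carrier N"
    and "\<And>x y. x \<in> carrier M \<Longrightarrow> y \<in> carrier M \<Longrightarrow> f (x \<oplus>\<^bsub>M\<^esub> y) = f x \<oplus>\<^bsub>N\<^esub> f y"
    and "\<And>a x. a \<in> carrier R \<Longrightarrow> x \<in> carrier M \<Longrightarrow> f (a \<odot>\<^bsub>M\<^esub> x) = a \<odot>\<^bsub>N\<^esub> f x"
  shows "f \<in> Hom R M N"
  using assms by (auto simp: Hom_def)

lemma Hom_closed: "f \<in> Hom R M N \<Longrightarrow> x \<in> carrier M \<Longrightarrow> f x \<in> carrier N"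
  by (auto simp: Hom_def)

lemma Hom_add:
  "f \<in> Hom R M N \<Longrightarrow> x \<in> carrier M \<Longrightarrow> y \<in> carrier M \<Longrightarrow> f (x \<oplus>\<^bsub>M\<^esub> y) = f x \<oplus>\<^bsub>N\<^esub> f y"
  by (auto simp: Hom_def)

lemma Hom_smult:
  "f \<in> Hom R M N \<Longrightarrow> a \<in> carrier R \<Longrightarrow> x \<in> carrier M \<Longrightarrow> f (a \<odot>\<^bsub>M\<^esub> x) = a \<odot>\<^bsub>N\<^esub> f x"
  by (auto simp: Hom_def)

lemma Hom_compose:
  assumes "f \<in> Hom R L M" "g \<in> Hom R M N"
  shows "(\<lambda>x. g (f x)) \<in> Hom R L N"
  using assms by (auto simp: Hom_def Pi_iff)

lemma (in abelian_group) minus_eq_zero_iff: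
  assumes "x \<in> carrier G" "y \<in> carrier G"
  shows "x \<ominus> y = \<zero> \<longleftrightarrow> x = y"
  using assms by (metis a_minus_def minus_equality minus_minus r_neg a_inv_closed)

lemma (in abelian_group) minus_add_cancel:
  assumes "x \<in> carrier G" "y \<in> carrier G"
  shows "x \<ominus> y \<oplus> y = x"
  using assms by (simp add: a_minus_def a_assoc l_neg)

lemma (in abelian_group) add_minus_cancel:
  assumes "x \<in> carrier G" "y \<in> carrier G"
  shows "x \<oplus> y \<ominus> y = x"
  using assms by (simp add: a_minus_def a_assoc r_neg)

lemma (in abelian_group) add_minus_add:
  assumes "x \<in> carrier G" "y \<in> carrier G" "u \<in> carrier G" "v \<in> carrier G"
  shows "(x \<oplus> y) \<ominus> (u \<oplus> v) = (x \<ominus> u) \<oplus> (y \<ominus> v)"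
  using assms by (simp add: a_minus_def minus_add a_ac)

context left_module
begin

lemma smult_zero: "a \<in> carrier R \<Longrightarrow> a \<odot>\<^bsub>M\<^esub> \<zero>\<^bsub>M\<^esub> = \<zero>\<^bsub>M\<^esub>"
  by (metis M.add.r_cancel_one M.zero_closed M.l_zero smult_closed smult_r_distr)

lemma zero_smult: "x \<in> carrier M \<Longrightarrow> \<zero>\<^bsub>R\<^esub> \<odot>\<^bsub>M\<^esub> x = \<zero>\<^bsub>M\<^esub>"
  by (metis M.add.r_cancel_one R.zero_closed R.l_zero smult_closed smult_l_distr)

lemma uminus_smult:
  assumes "a \<in> carrier R" "x \<in> carrier M"
  shows "(\<ominus>\<^bsub>R\<^esub> a) \<odot>\<^bsub>M\<^esub> x = \<ominus>\<^bsub>M\<^esub> (a \<odot>\<^bsub>M\<^esub> x)"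
  using assms
  by (metis M.minus_equality R.a_inv_closed R.l_neg smult_closed smult_l_distr zero_smult)

lemma smult_uminus:
  assumes "a \<in> carrier R" "x \<in> carrier M"
  shows "a \<odot>\<^bsub>M\<^esub> (\<ominus>\<^bsub>M\<^esub> x) = \<ominus>\<^bsub>M\<^esub> (a \<odot>\<^bsub>M\<^esub> x)"
  using assms
  by (metis M.minus_equality M.a_inv_closed M.l_neg smult_closed smult_r_distr smult_zero)

lemma smult_diff:
  assumes "a \<in> carrier R" "x \<in> carrier M" "y \<in> carrier M"
  shows "a \<odot>\<^bsub>M\<^esub> (x \<ominus>\<^bsub>M\<^esub> y) = a \<odot>\<^bsub>M\<^esub> x \<ominus>\<^bsub>M\<^esub> a \<odot>\<^bsub>M\<^esub> y"
  using assms by (simp add: M.minus_eq smult_r_distr smult_uminus)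

lemma submoduleI:
  assumes sub: "H \<subseteq> carrier M"
    and zero: "\<zero>\<^bsub>M\<^esub> \<in> H"
    and add: "\<And>x y. x \<in> H \<Longrightarrow> y \<in> H \<Longrightarrow> x \<oplus>\<^bsub>M\<^esub> y \<in> H"
    and smult: "\<And>a x. a \<in> carrier R \<Longrightarrow> x \<in> H \<Longrightarrow> a \<odot>\<^bsub>M\<^esub> x \<in> H"
  shows "submodule H R M"
proof -
  have "\<ominus>\<^bsub>M\<^esub> x \<in> H" if "x \<in> H" for x
    using smult[of "\<ominus>\<^bsub>R\<^esub> \<one>\<^bsub>R\<^esub>" x] that sub uminus_smult[of "\<one>\<^bsub>R\<^esub>" x] by auto
  then show ?thesis
    using assms
    by (intro submodule.intro subgroup.intro submodule_axioms.intro) (auto simp: a_inv_def)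
qed

lemma submoduleD:
  assumes "submodule H R M"
  shows "H \<subseteq> carrier M" "\<zero>\<^bsub>M\<^esub> \<in> H"
    and "\<And>x y. x \<in> H \<Longrightarrow> y \<in> H \<Longrightarrow> x \<oplus>\<^bsub>M\<^esub> y \<in> H"
    and "\<And>a x. a \<in> carrier R \<Longrightarrow> x \<in> H \<Longrightarrow> a \<odot>\<^bsub>M\<^esub> x \<in> H"
    and "\<And>x y. x \<in> H \<Longrightarrow> y \<in> H \<Longrightarrow> x \<ominus>\<^bsub>M\<^esub> y \<in> H"
proof -
  have sg: "subgroup H (add_monoid M)"
    using assms by (rule submodule.axioms)
  show sub: "H \<subseteq> carrier M" and "\<zero>\<^bsub>M\<^esub> \<in> H"
    and add: "\<And>x y. x \<in> H \<Longrightarrow> y \<in> H \<Longrightarrow> x \<oplus>\<^bsub>M\<^esub> y \<in> H"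
    using subgroup.subset[OF sg] subgroup.one_closed[OF sg] subgroup.m_closed[OF sg] by auto
  show "\<And>a x. a \<in> carrier R \<Longrightarrow> x \<in> H \<Longrightarrow> a \<odot>\<^bsub>M\<^esub> x \<in> H"
    using assms by (rule submodule.smult_closed)
  show "\<And>x y. x \<in> H \<Longrightarrow> y \<in> H \<Longrightarrow> x \<ominus>\<^bsub>M\<^esub> y \<in> H"
    using add subgroup.m_inv_closed[OF sg] by (simp add: M.minus_eq a_inv_def)
qed

end

lemma Hom_zero:
  assumes "left_module R M" "left_module R N" "f \<in> Hom R M N"
  shows "f \<zero>\<^bsub>M\<^esub> = \<zero>\<^bsub>N\<^esub>"
proof -
  interpret M: left_module R M by fact
  interpret N: left_module R N by fact
  have "f \<zero>\<^bsub>M\<^esub> \<oplus>\<^bsub>N\<^esub> f \<zero>\<^bsub>M\<^esub> = f \<zero>\<^bsub>M\<^esub>"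
    using Hom_add[OF assms(3), of "\<zero>\<^bsub>M\<^esub>" "\<zero>\<^bsub>M\<^esub>"] by simp
  then show ?thesis
    using Hom_closed[OF assms(3) M.M.zero_closed] by (simp add: N.M.add.r_cancel_one)
qed

lemma Hom_diff:
  assumes "left_module R M" "left_module R N" "f \<in> Hom R M N"
    and "x \<in> carrier M" "y \<in> carrier M"
  shows "f (x \<ominus>\<^bsub>M\<^esub> y) = f x \<ominus>\<^bsub>N\<^esub> f y"
proof -
  interpret M: left_module R M by fact
  interpret N: left_module R N by fact
  have "f (x \<ominus>\<^bsub>M\<^esub> y) \<oplus>\<^bsub>N\<^esub> f y = f x"
    using assms(4,5) by (simp flip: Hom_add[OF assms(3)] add: M.M.minus_add_cancel)
  then show ?thesis
    using assms(4,5) Hom_closed[OF assms(3)]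
    by (metis N.M.add_minus_cancel M.M.minus_closed)
qed

lemma Hom_pointwise_diff:
  assumes "left_module R N" "f \<in> Hom R M N" "g \<in> Hom R M N"
  shows "(\<lambda>x. f x \<ominus>\<^bsub>N\<^esub> g x) \<in> Hom R M N"
proof -
  interpret N: left_module R N by fact
  show ?thesis
    using assms(2,3)
    by (intro HomI)
      (simp_all add: Hom_closed[where N = N] Hom_add[where N = N] Hom_smult[where N = N]
        N.M.add_minus_add N.smult_diff)
qed

lemma Hom_image_submodule:
  assumes "left_module R M" "left_module R N" "f \<in> Hom R M N"
  shows "submodule (f ` carrier M) R N"
proof -
  interpret M: left_module R M by fact
  interpret N: left_module R N by fact
  show ?thesis
  proof (rule N.submoduleI)
    show "\<zero>\<^bsub>N\<^esub> \<in> f ` carrier M"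
      using Hom_zero[OF assms] M.M.zero_closed by (metis imageI)
  qed (auto simp: Hom_closed[OF assms(3)] image_iff
      simp flip: Hom_add[OF assms(3)] Hom_smult[OF assms(3)])
qed

lemma complement_projection:
  fixes M :: "('r, 'm) module"
  assumes M: "left_module R M" and S: "submodule S R M" and C: "submodule C R M"
    and sum: "S <+>\<^bsub>M\<^esub> C = carrier M" and int: "S \<inter> C = {\<zero>\<^bsub>M\<^esub>}"
  obtains \<rho> where "\<rho> \<in> Hom R M M" "\<And>x. x \<in> S \<Longrightarrow> \<rho> x = \<zero>\<^bsub>M\<^esub>"
    "\<And>x. x \<in> carrier M \<Longrightarrow> x \<ominus>\<^bsub>M\<^esub> \<rho> x \<in> S"
proof -
  interpret left_module R M by fact
  note S = submoduleD[OF S] and C = submoduleD[OF C]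
  have unique: "c = d"
    if "x \<in> carrier M" "c \<in> C" "d \<in> C" "x \<ominus>\<^bsub>M\<^esub> c \<in> S" "x \<ominus>\<^bsub>M\<^esub> d \<in> S" for x c d
  proof -
    have c: "c \<in> carrier M" "d \<in> carrier M" using that C by auto
    have "(x \<ominus>\<^bsub>M\<^esub> d) \<ominus>\<^bsub>M\<^esub> (x \<ominus>\<^bsub>M\<^esub> c) = (x \<ominus>\<^bsub>M\<^esub> x) \<oplus>\<^bsub>M\<^esub> (c \<ominus>\<^bsub>M\<^esub> d)"
      using c \<open>x \<in> _\<close> by (simp add: M.minus_eq M.minus_add M.a_ac)
    moreover have "x \<ominus>\<^bsub>M\<^esub> x = \<zero>\<^bsub>M\<^esub>"
      using \<open>x \<in> _\<close> by (simp add: M.minus_eq M.r_neg)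
    ultimately have "c \<ominus>\<^bsub>M\<^esub> d \<in> S"
      using c S(5)[OF that(5,4)] by simp
    then have "c \<ominus>\<^bsub>M\<^esub> d = \<zero>\<^bsub>M\<^esub>"
      using int C(5)[OF that(2,3)] by blast
    with c show ?thesis
      by (simp add: M.minus_eq_zero_iff)
  qed
  have "\<forall>x\<in>carrier M. \<exists>c. c \<in> C \<and> x \<ominus>\<^bsub>M\<^esub> c \<in> S"
  proof
    fix x assume "x \<in> carrier M"
    then obtain s c where "s \<in> S" "c \<in> C" "x = s \<oplus>\<^bsub>M\<^esub> c"
      unfolding sum[symmetric] set_add_def' by blast
    then show "\<exists>c. c \<in> C \<and> x \<ominus>\<^bsub>M\<^esub> c \<in> S"
      using S C by (auto simp: M.add_minus_cancel subset_iff intro!: exI[of _ c])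
  qed
  then obtain \<rho> where \<rho>: "\<And>x. x \<in> carrier M \<Longrightarrow> \<rho> x \<in> C \<and> x \<ominus>\<^bsub>M\<^esub> \<rho> x \<in> S"
    by metis
  have \<rho>_closed: "\<rho> x \<in> carrier M" if "x \<in> carrier M" for x
    using \<rho> that C by blast
  show thesis
  proof
    show "\<rho> \<in> Hom R M M"
    proof (rule HomI)
      fix x y assume xy: "x \<in> carrier M" "y \<in> carrier M"
      then have "(x \<oplus>\<^bsub>M\<^esub> y) \<ominus>\<^bsub>M\<^esub> (\<rho> x \<oplus>\<^bsub>M\<^esub> \<rho> y) \<in> S"
        using \<rho> \<rho>_closed S by (simp add: M.add_minus_add)
      with xy show "\<rho> (x \<oplus>\<^bsub>M\<^esub> y) = \<rho> x \<oplus>\<^bsub>M\<^esub> \<rho> y"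
        using \<rho> C by (intro unique[of "x \<oplus>\<^bsub>M\<^esub> y"]) auto
    next
      fix a x assume ax: "a \<in> carrier R" "x \<in> carrier M"
      then have "a \<odot>\<^bsub>M\<^esub> x \<ominus>\<^bsub>M\<^esub> a \<odot>\<^bsub>M\<^esub> \<rho> x \<in> S"
        using \<rho> \<rho>_closed S by (simp flip: smult_diff)
      with ax show "\<rho> (a \<odot>\<^bsub>M\<^esub> x) = a \<odot>\<^bsub>M\<^esub> \<rho> x"
        using \<rho> C by (intro unique[of "a \<odot>\<^bsub>M\<^esub> x"]) auto
    qed (fact \<rho>_closed)
    show "\<rho> x = \<zero>\<^bsub>M\<^esub>" if "x \<in> S" for x
      using that S C \<rho> by (intro unique[of x]) (auto simp: M.minus_eq)
    show "x \<ominus>\<^bsub>M\<^esub> \<rho> x \<in> S" if "x \<in> carrier M" for x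
      using \<rho> that by blast
  qed
qed

lemma factor_through_quotient:
  fixes R :: "('r, 'c) ring_scheme" and N :: "('r, 'n) module" and M :: "('r, 'm) module"
    and X :: "('r, 'x) module"
  assumes N: "left_module R N" and M: "left_module R M"
    and L: "submodule L R N" and K: "submodule K R N" and KL: "K \<subseteq> L"
    and iso: "isomorphic R (quotient_module (restrict_module N L) K) X"
    and k: "k \<in> Hom R N M" and kK: "\<And>x. x \<in> K \<Longrightarrow> k x = \<zero>\<^bsub>M\<^esub>"
  obtains h where "h \<in> Hom R X M" "h ` carrier X = k ` L"
proof -
  interpret N: left_module R N by fact
  interpret M: left_module R M by fact
  note L = N.submoduleD[OF L] and K = N.submoduleD[OF K]
  let ?Q = "quotient_module (restrict_module N L) K"
  define c where "c n = (\<lambda>k. k \<oplus>\<^bsub>N\<^esub> n) ` K" for n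
  have coset: "K +>\<^bsub>restrict_module N L\<^esub> n = c n" for n
    by (auto simp: a_r_coset_def' restrict_module_def c_def)
  have carrierQ: "carrier ?Q = c ` L"
    by (auto simp: quotient_module_def A_RCOSETS_def' coset)
       (auto simp: restrict_module_def)
  have c_self: "n \<in> c n" if "n \<in> L" for n
    using that K(2) L(1) by (auto simp: c_def image_iff intro!: bexI[of _ "\<zero>\<^bsub>N\<^esub>"])
  have c_add: "c n \<oplus>\<^bsub>?Q\<^esub> c n' = c (n \<oplus>\<^bsub>N\<^esub> n')" if "n \<in> L" "n' \<in> L" for n n'
  proof -
    have n: "n \<in> carrier N" "n' \<in> carrier N" using that L(1) by auto
    have sum: "(k \<oplus>\<^bsub>N\<^esub> n) \<oplus>\<^bsub>N\<^esub> (k' \<oplus>\<^bsub>N\<^esub> n') = (k \<oplus>\<^bsub>N\<^esub> k') \<oplus>\<^bsub>N\<^esub> (n \<oplus>\<^bsub>N\<^esub> n')"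
      if "k \<in> K" "k' \<in> K" for k k'
    proof -
      have "k \<in> carrier N" "k' \<in> carrier N" using that K(1) by auto
      then show ?thesis using n by (simp add: N.M.a_ac)
    qed
    have "c n \<oplus>\<^bsub>?Q\<^esub> c n' = (\<Union>k\<in>K. \<Union>k'\<in>K. {(k \<oplus>\<^bsub>N\<^esub> n) \<oplus>\<^bsub>N\<^esub> (k' \<oplus>\<^bsub>N\<^esub> n')})"
      by (auto simp: quotient_module_def set_add_def' restrict_module_def c_def)
    also have "\<dots> = (\<Union>k\<in>K. \<Union>k'\<in>K. {(k \<oplus>\<^bsub>N\<^esub> k') \<oplus>\<^bsub>N\<^esub> (n \<oplus>\<^bsub>N\<^esub> n')})"
      by (simp add: sum)
    also have "\<dots> = c (n \<oplus>\<^bsub>N\<^esub> n')"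
    proof
      show "(\<Union>k\<in>K. \<Union>k'\<in>K. {(k \<oplus>\<^bsub>N\<^esub> k') \<oplus>\<^bsub>N\<^esub> (n \<oplus>\<^bsub>N\<^esub> n')}) \<subseteq> c (n \<oplus>\<^bsub>N\<^esub> n')"
        using K(3) by (auto simp: c_def)
      have "k \<oplus>\<^bsub>N\<^esub> \<zero>\<^bsub>N\<^esub> = k" if "k \<in> K" for k
        using that K(1) by auto
      then show "c (n \<oplus>\<^bsub>N\<^esub> n') \<subseteq> (\<Union>k\<in>K. \<Union>k'\<in>K. {(k \<oplus>\<^bsub>N\<^esub> k') \<oplus>\<^bsub>N\<^esub> (n \<oplus>\<^bsub>N\<^esub> n')})"
        using K(2) by (force simp: c_def)
    qed
    finally show ?thesis .
  qed
  have c_absorb: "c (k \<oplus>\<^bsub>N\<^esub> n) = c n" if "k \<in> K" "n \<in> carrier N" for k n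
  proof -
    have kc: "k \<in> carrier N" using that K(1) by auto
    have "\<exists>k''\<in>K. k' \<oplus>\<^bsub>N\<^esub> n = k'' \<oplus>\<^bsub>N\<^esub> (k \<oplus>\<^bsub>N\<^esub> n)" if k': "k' \<in> K" for k'
    proof
      have "k' \<in> carrier N" using k' K(1) by auto
      then show "k' \<oplus>\<^bsub>N\<^esub> n = (k' \<ominus>\<^bsub>N\<^esub> k) \<oplus>\<^bsub>N\<^esub> (k \<oplus>\<^bsub>N\<^esub> n)"
        using kc \<open>n \<in> carrier N\<close> by (simp flip: N.M.a_assoc add: N.M.minus_add_cancel)
    qed (use K(5) k' \<open>k \<in> K\<close> in auto)
    moreover have "\<exists>k''\<in>K. k' \<oplus>\<^bsub>N\<^esub> (k \<oplus>\<^bsub>N\<^esub> n) = k'' \<oplus>\<^bsub>N\<^esub> n" if k': "k' \<in> K" for k'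
    proof
      have "k' \<in> carrier N" using k' K(1) by auto
      then show "k' \<oplus>\<^bsub>N\<^esub> (k \<oplus>\<^bsub>N\<^esub> n) = (k' \<oplus>\<^bsub>N\<^esub> k) \<oplus>\<^bsub>N\<^esub> n"
        using kc \<open>n \<in> carrier N\<close> by (simp add: N.M.a_assoc)
    qed (use K(3) k' \<open>k \<in> K\<close> in auto)
    ultimately show ?thesis by (auto simp: c_def)
  qed
  have c_smult: "a \<odot>\<^bsub>?Q\<^esub> c n = c (a \<odot>\<^bsub>N\<^esub> n)" if "a \<in> carrier R" "n \<in> L" for a n
  proof -
    have n: "n \<in> carrier N" using that L(1) by auto
    have y_eq: "c (a \<odot>\<^bsub>N\<^esub> y) = c (a \<odot>\<^bsub>N\<^esub> n)" if "y \<in> c n" for y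
    proof -
      obtain k where y: "k \<in> K" "y = k \<oplus>\<^bsub>N\<^esub> n" using \<open>y \<in> c n\<close> by (auto simp: c_def)
      then have "k \<in> carrier N" using K(1) by auto
      with y n \<open>a \<in> _\<close> K(4) show ?thesis
        by (simp add: N.smult_r_distr c_absorb)
    qed
    have "a \<odot>\<^bsub>?Q\<^esub> c n = (\<Union>y\<in>c n. c (a \<odot>\<^bsub>N\<^esub> y))"
      by (simp add: quotient_module_def coset) (simp add: restrict_module_def)
    also have "\<dots> = (\<Union>y\<in>c n. c (a \<odot>\<^bsub>N\<^esub> n))"
      by (simp add: y_eq)
    also have "\<dots> = c (a \<odot>\<^bsub>N\<^esub> n)"
      using c_self[OF \<open>n \<in> L\<close>] by blast
    finally show ?thesis .
  qed
  obtain q where q: "q \<in> Hom R ?Q X" and bij: "bij_betw q (carrier ?Q) (carrier X)"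
    using iso by (auto simp: isomorphic_def)
  define s where "s n = q (c n)" for n
  have s_img: "s ` L = carrier X"
    using bij by (auto simp: bij_betw_def carrierQ s_def image_image)
  have s_add: "s (n \<oplus>\<^bsub>N\<^esub> n') = s n \<oplus>\<^bsub>X\<^esub> s n'" if "n \<in> L" "n' \<in> L" for n n'
    using that carrierQ by (simp add: s_def flip: c_add Hom_add[OF q])
  have s_smult: "s (a \<odot>\<^bsub>N\<^esub> n) = a \<odot>\<^bsub>X\<^esub> s n" if "a \<in> carrier R" "n \<in> L" for a n
    using that carrierQ by (simp add: s_def flip: c_smult Hom_smult[OF q])
  have s_eq: "k n = k n'" if n: "n \<in> L" "n' \<in> L" "s n = s n'" for n n'
  proof -
    have "c n = c n'"
      using n bij carrierQ by (auto simp: s_def bij_betw_def inj_on_def)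
    then obtain z where z: "z \<in> K" "n = z \<oplus>\<^bsub>N\<^esub> n'"
      using c_self[OF n(1)] by (auto simp: c_def)
    then have "z \<in> carrier N" "n' \<in> carrier N" using K(1) L(1) n by auto
    then show ?thesis
      using z by (simp add: Hom_add[OF k] kK Hom_closed[OF k])
  qed
  define h where "h x = k (inv_into L s x)" for x
  have hs: "h (s n) = k n" if "n \<in> L" for n
    unfolding h_def using that by (intro s_eq) (auto intro: inv_into_into f_inv_into_f)
  have img: "h ` carrier X = k ` L"
    unfolding s_img[symmetric] image_image by (rule image_cong) (simp_all add: hs)
  have "h \<in> Hom R X M"
  proof (rule HomI)
    fix x assume "x \<in> carrier X"
    then obtain n where n: "n \<in> L" "x = s n"
      unfolding s_img[symmetric] by blast
    then have "n \<in> carrier N" using L(1) by auto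
    with n show "h x \<in> carrier M"
      by (simp add: hs Hom_closed[OF k])
  next
    fix x y assume "x \<in> carrier X" "y \<in> carrier X"
    then obtain n n' where n: "n \<in> L" "n' \<in> L" "x = s n" "y = s n'"
      unfolding s_img[symmetric] by blast
    then have "n \<in> carrier N" "n' \<in> carrier N" using L(1) by auto
    with n L(3) show "h (x \<oplus>\<^bsub>X\<^esub> y) = h x \<oplus>\<^bsub>M\<^esub> h y"
      by (simp add: hs Hom_add[OF k] flip: s_add)
  next
    fix a x assume a: "a \<in> carrier R" "x \<in> carrier X"
    then obtain n where n: "n \<in> L" "x = s n"
      unfolding s_img[symmetric] by blast
    then have "n \<in> carrier N" using L(1) by auto
    with n a L(4) show "h (a \<odot>\<^bsub>X\<^esub> x) = a \<odot>\<^bsub>M\<^esub> h x"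
      by (simp add: hs Hom_smult[OF k] flip: s_smult)
  qed
  with img show thesis using that by blast
qed

section \<open>Semibricks and sums of images of bricks\<close>

lemma brick_endomorphism_inverse:
  fixes R :: "('r, 'c) ring_scheme" and B :: "('r, 'm) module"
  assumes B: "brick R B" and g: "g \<in> Hom R B B" and x: "x \<in> carrier B" "g x \<noteq> \<zero>\<^bsub>B\<^esub>"
  obtains h where "h \<in> Hom R B B" "\<And>y. y \<in> carrier B \<Longrightarrow> h (g y) = y"
    "\<And>y. y \<in> carrier B \<Longrightarrow> g (h y) = y"
proof -
  let ?E = "End_ring R B"
  let ?g = "restrict g (carrier B)"
  have "?g \<in> carrier ?E"
  proof -
    interpret left_module R B using B by (simp add: brick_def)
    have "?g \<in> Hom R B B"
      using g by (auto simp: Hom_def)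
    then show ?thesis by (simp add: End_ring_def)
  qed
  moreover have "?g \<noteq> \<zero>\<^bsub>?E\<^esub>"
    using x by (auto simp: End_ring_def fun_eq_iff)
  ultimately have "?g \<in> Units ?E"
    using B by (simp add: brick_def is_division_ring_def)
  then obtain h where h: "h \<in> carrier ?E" "h \<otimes>\<^bsub>?E\<^esub> ?g = \<one>\<^bsub>?E\<^esub>" "?g \<otimes>\<^bsub>?E\<^esub> h = \<one>\<^bsub>?E\<^esub>"
    by (auto simp: Units_def)
  then have hom: "h \<in> Hom R B B"
    by (simp add: End_ring_def)
  show thesis
  proof
    fix y assume y: "y \<in> carrier B"
    show "h (g y) = y"
      using fun_cong[OF h(2), of y] y by (simp add: End_ring_def compose_def)
    show "g (h y) = y"
      using fun_cong[OF h(3), of y] y Hom_closed[OF hom y] by (simp add: End_ring_def compose_def)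
  qed (fact hom)
qed

definition brick_image ::
  "('r, 'c) ring_scheme \<Rightarrow> ('r, 'x) module set \<Rightarrow> ('r, 'm) module \<Rightarrow> 'm set \<Rightarrow> bool" where
  "brick_image R \<X> M Y \<longleftrightarrow> (\<exists>X\<in>\<X>. \<exists>g\<in>Hom R X M. Y = g ` carrier X)"

inductive_set finite_sums :: "('r, 'm) module \<Rightarrow> 'm set set \<Rightarrow> 'm set"
  for M :: "('r, 'm) module" and \<Y> :: "'m set set" where
  zero: "\<zero>\<^bsub>M\<^esub> \<in> finite_sums M \<Y>"
| add: "t \<in> finite_sums M \<Y> \<Longrightarrow> Y \<in> \<Y> \<Longrightarrow> y \<in> Y \<Longrightarrow> t \<oplus>\<^bsub>M\<^esub> y \<in> finite_sums M \<Y>"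

lemma finite_sums_mono: "\<Y> \<subseteq> \<Y>' \<Longrightarrow> finite_sums M \<Y> \<subseteq> finite_sums M \<Y>'"
proof
  fix t assume "t \<in> finite_sums M \<Y>" "\<Y> \<subseteq> \<Y>'"
  then show "t \<in> finite_sums M \<Y>'"
    by (induction t rule: finite_sums.induct) (auto intro: finite_sums.intros)
qed

lemma finite_sums_submodule:
  fixes R :: "('r, 'c) ring_scheme" and M :: "('r, 'm) module"
  assumes M: "left_module R M" and \<Y>: "\<And>Y. Y \<in> \<Y> \<Longrightarrow> submodule Y R M"
  shows "submodule (finite_sums M \<Y>) R M"
proof -
  interpret left_module R M by fact
  note Y = submoduleD[OF \<Y>]
  have closed: "t \<in> carrier M" if "t \<in> finite_sums M \<Y>" for t
    using that by (induction t rule: finite_sums.induct) (use Y(1) in blast)+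
  show ?thesis
  proof (rule submoduleI)
    show "x \<oplus>\<^bsub>M\<^esub> y \<in> finite_sums M \<Y>"
      if x: "x \<in> finite_sums M \<Y>" and "y \<in> finite_sums M \<Y>" for x y
      using that(2)
    proof (induction y rule: finite_sums.induct)
      case zero
      show ?case using x closed by simp
    next
      case (add t Y y)
      then have "y \<in> carrier M" using Y(1) by blast
      then have "x \<oplus>\<^bsub>M\<^esub> (t \<oplus>\<^bsub>M\<^esub> y) = (x \<oplus>\<^bsub>M\<^esub> t) \<oplus>\<^bsub>M\<^esub> y"
        using x add.hyps closed by (simp add: M.a_assoc)
      then show ?case using add by (auto intro: finite_sums.add)
    qed
    show "a \<odot>\<^bsub>M\<^esub> x \<in> finite_sums M \<Y>" if a: "a \<in> carrier R" and "x \<in> finite_sums M \<Y>" for a x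
      using that(2)
    proof (induction x rule: finite_sums.induct)
      case zero
      show ?case using a by (simp add: smult_zero finite_sums.zero)
    next
      case (add t Y y)
      then have "y \<in> carrier M" using Y(1) by blast
      then show ?case
        using add a closed Y(4)[OF add.hyps(2)] by (auto simp: smult_r_distr intro: finite_sums.add)
    qed
  qed (auto intro: closed finite_sums.zero)
qed

lemma finite_sums_incl:
  fixes R :: "('r, 'c) ring_scheme" and M :: "('r, 'm) module"
  assumes M: "left_module R M" and Y: "Y \<in> \<Y>" "Y \<subseteq> carrier M"
  shows "Y \<subseteq> finite_sums M \<Y>"
proof
  interpret left_module R M by fact
  fix y assume y: "y \<in> Y"
  then have "\<zero>\<^bsub>M\<^esub> \<oplus>\<^bsub>M\<^esub> y \<in> finite_sums M \<Y>"
    using Y by (intro finite_sums.intros)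
  then show "y \<in> finite_sums M \<Y>"
    using y Y by auto
qed

section \<open>Complements in semisimple modules\<close>

locale semisimple_decomposition = left_module R M
  for R :: "('r, 'c) ring_scheme" and M :: "('r, 'm) module" +
  fixes \<X> :: "('r, 'x) module set" and I :: "'i set" and F :: "'i \<Rightarrow> ('r, 'x) module"
    and \<phi> :: "'m \<Rightarrow> 'i \<Rightarrow> 'x"
  assumes semibrick: "semibrick R \<X>"
    and F: "i \<in> I \<Longrightarrow> F i \<in> \<X>"
    and \<phi>_Hom: "\<phi> \<in> Hom R M (direct_sum I F)"
    and \<phi>_bij: "bij_betw \<phi> (carrier M) (carrier (direct_sum I F))"
begin

lemma brick: "X \<in> \<X> \<Longrightarrow> brick R X"
  using semibrick by (simp add: semibrick_def)

lemma brick_module: "X \<in> \<X> \<Longrightarrow> left_module R X"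
  using brick by (simp add: brick_def)

lemma left_module_M: "left_module R M"
  by (rule left_module_axioms)

lemma F_zero_closed: "i \<in> I \<Longrightarrow> \<zero>\<^bsub>F i\<^esub> \<in> carrier (F i)"
  using brick_module[OF F, of i]
  by (simp add: left_module_def abelian_group.axioms(1) abelian_monoid.zero_closed)

lemma
  assumes "i \<in> I"
  shows F_add_zero: "\<zero>\<^bsub>F i\<^esub> \<oplus>\<^bsub>F i\<^esub> \<zero>\<^bsub>F i\<^esub> = \<zero>\<^bsub>F i\<^esub>"
    and F_smult_zero: "a \<in> carrier R \<Longrightarrow> a \<odot>\<^bsub>F i\<^esub> \<zero>\<^bsub>F i\<^esub> = \<zero>\<^bsub>F i\<^esub>"
proof -
  interpret F: left_module R "F i"
    using assms by (intro brick_module F)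
  show "\<zero>\<^bsub>F i\<^esub> \<oplus>\<^bsub>F i\<^esub> \<zero>\<^bsub>F i\<^esub> = \<zero>\<^bsub>F i\<^esub>"
    and "a \<in> carrier R \<Longrightarrow> a \<odot>\<^bsub>F i\<^esub> \<zero>\<^bsub>F i\<^esub> = \<zero>\<^bsub>F i\<^esub>"
    by (auto simp: F.smult_zero)
qed

lemma coord_Hom:
  assumes i: "i \<in> I"
  shows "(\<lambda>m. \<phi> m i) \<in> Hom R M (F i)"
  using i Hom_closed[OF \<phi>_Hom] Hom_add[OF \<phi>_Hom] Hom_smult[OF \<phi>_Hom]
  by (intro HomI) (auto simp: direct_sum_def)

lemma coord_zero: "i \<in> I \<Longrightarrow> \<phi> \<zero>\<^bsub>M\<^esub> i = \<zero>\<^bsub>F i\<^esub>"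
  using Hom_zero[OF left_module_M brick_module[OF F] coord_Hom] .

lemma coord_diff:
  "i \<in> I \<Longrightarrow> x \<in> carrier M \<Longrightarrow> y \<in> carrier M \<Longrightarrow> \<phi> (x \<ominus>\<^bsub>M\<^esub> y) i = \<phi> x i \<ominus>\<^bsub>F i\<^esub> \<phi> y i"
  using Hom_diff[OF left_module_M brick_module[OF F] coord_Hom] .

lemma coord_eqI:
  assumes "m \<in> carrier M" "m' \<in> carrier M" "\<And>i. i \<in> I \<Longrightarrow> \<phi> m i = \<phi> m' i"
  shows "m = m'"
proof -
  have "\<phi> m = \<phi> m'"
    using assms(3) Hom_closed[OF \<phi>_Hom assms(1)] Hom_closed[OF \<phi>_Hom assms(2)]
    by (intro extensionalityI[of _ I]) (auto simp: direct_sum_def PiE_def)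
  then show ?thesis
    using assms \<phi>_bij by (auto simp: bij_betw_def inj_on_def)
qed

lemma finite_support: "m \<in> carrier M \<Longrightarrow> finite {i \<in> I. \<phi> m i \<noteq> \<zero>\<^bsub>F i\<^esub>}"
  using Hom_closed[OF \<phi>_Hom, of m] by (simp add: direct_sum_def)

definition injection :: "'i \<Rightarrow> 'x \<Rightarrow> 'm" where
  "injection i x = inv_into (carrier M) \<phi> (\<lambda>j\<in>I. if j = i then x else \<zero>\<^bsub>F j\<^esub>)"

lemma
  assumes "i \<in> I" "x \<in> carrier (F i)"
  shows injection_closed: "injection i x \<in> carrier M"
    and coord_injection: "j \<in> I \<Longrightarrow> \<phi> (injection i x) j = (if j = i then x else \<zero>\<^bsub>F j\<^esub>)"
proof -
  let ?d = "\<lambda>j\<in>I. if j = i then x else \<zero>\<^bsub>F j\<^esub>"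
  have "{j \<in> I. ?d j \<noteq> \<zero>\<^bsub>F j\<^esub>} \<subseteq> {i}"
    by auto
  then have "finite {j \<in> I. ?d j \<noteq> \<zero>\<^bsub>F j\<^esub>}"
    using finite_subset by blast
  then have d: "?d \<in> \<phi> ` carrier M"
    using assms \<phi>_bij F_zero_closed by (auto simp: bij_betw_def direct_sum_def)
  then show "injection i x \<in> carrier M"
    unfolding injection_def by (rule inv_into_into)
  show "\<phi> (injection i x) j = (if j = i then x else \<zero>\<^bsub>F j\<^esub>)" if "j \<in> I"
    unfolding injection_def f_inv_into_f[OF d] using that by simp
qed

lemma injection_Hom:
  assumes i: "i \<in> I"
  shows "injection i \<in> Hom R (F i) M"
proof (rule HomI)
  interpret F: left_module R "F i"
    using i by (intro brick_module F)
  fix x assume x: "x \<in> carrier (F i)"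
  show "injection i x \<in> carrier M"
    using i x by (rule injection_closed)
  show "injection i (x \<oplus>\<^bsub>F i\<^esub> y) = injection i x \<oplus>\<^bsub>M\<^esub> injection i y" if y: "y \<in> carrier (F i)" for y
    using i x y
    by (intro coord_eqI)
      (auto simp: injection_closed Hom_add[OF coord_Hom] coord_injection F_add_zero)
  show "injection i (a \<odot>\<^bsub>F i\<^esub> x) = a \<odot>\<^bsub>M\<^esub> injection i x" if a: "a \<in> carrier R" for a
    using i x a
    by (intro coord_eqI)
      (auto simp: injection_closed Hom_smult[OF coord_Hom] coord_injection F_smult_zero)
qed

lemma brick_image_submodule: "brick_image R \<X> M Y \<Longrightarrow> submodule Y R M"
  unfolding brick_image_def
  by (auto intro!: Hom_image_submodule brick_module left_module_M)

text \<open>Some coordinate of a nonzero homomorphism from a brick of the semibrick is nonzero; it is then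
  an endomorphism of that brick, hence invertible.\<close>

lemma Hom_brick_retraction:
  assumes X: "X \<in> \<X>" and g: "g \<in> Hom R X M" and x: "x \<in> carrier X" "g x \<noteq> \<zero>\<^bsub>M\<^esub>"
  obtains r where "r \<in> Hom R M X" "\<And>y. y \<in> carrier X \<Longrightarrow> r (g y) = y"
proof -
  obtain i where i: "i \<in> I" "\<phi> (g x) i \<noteq> \<zero>\<^bsub>F i\<^esub>"
    using coord_eqI[of "g x" "\<zero>\<^bsub>M\<^esub>"] x Hom_closed[OF g] coord_zero by auto
  have comp: "(\<lambda>y. \<phi> (g y) i) \<in> Hom R X (F i)"
    by (rule Hom_compose[OF g coord_Hom[OF i(1)]])
  have eq: "F i = X"
  proof -
    have "\<not> (\<forall>f\<in>Hom R X (F i). \<forall>x\<in>carrier X. f x = \<zero>\<^bsub>F i\<^esub>)"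
    proof
      assume "\<forall>f\<in>Hom R X (F i). \<forall>x\<in>carrier X. f x = \<zero>\<^bsub>F i\<^esub>"
      from bspec[OF bspec[OF this comp] x(1)] i(2) show False by simp
    qed
    moreover note bspec[OF bspec[OF conjunct2[OF semibrick[unfolded semibrick_def]] X] F[OF i(1)]]
    ultimately show ?thesis by blast
  qed
  show thesis
  proof (rule brick_endomorphism_inverse
      [OF brick[OF X] comp[unfolded eq] x(1) i(2)[unfolded eq]])
    fix h assume h: "h \<in> Hom R X X" "\<And>y. y \<in> carrier X \<Longrightarrow> h (\<phi> (g y) i) = y"
    show thesis
      using that[OF Hom_compose[OF coord_Hom[OF i(1)], of h X]] h eq by simp
  qed
qed

lemma Hom_brick_zero:
  assumes "X \<in> \<X>" "g \<in> Hom R X M" "x \<in> carrier X" "x \<noteq> \<zero>\<^bsub>X\<^esub>" "g x = \<zero>\<^bsub>M\<^esub>" "y \<in> carrier X"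
  shows "g y = \<zero>\<^bsub>M\<^esub>"
proof (rule ccontr)
  assume "g y \<noteq> \<zero>\<^bsub>M\<^esub>"
  then obtain r where "r \<in> Hom R M X" "\<And>y. y \<in> carrier X \<Longrightarrow> r (g y) = y"
    using Hom_brick_retraction assms(1,2,6) by metis
  then have "x = \<zero>\<^bsub>X\<^esub>"
    using assms Hom_zero[OF left_module_M brick_module] by metis
  with assms show False by simp
qed

text \<open>If \<open>U = ker e\<close> and \<open>r\<close> is a retraction of \<open>e \<circ> g\<close>, then \<open>U + g X\<close> is the kernel of
  \<open>e - e \<circ> g \<circ> r \<circ> e\<close>.\<close>

lemma finite_sums_kernel:
  assumes \<Y>: "\<And>Y. Y \<in> \<Y> \<Longrightarrow> brick_image R \<X> M Y" and t: "t \<in> finite_sums M \<Y>"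
  obtains e where "e \<in> Hom R M M" "e t = \<zero>\<^bsub>M\<^esub>"
    "\<And>m. m \<in> carrier M \<Longrightarrow> e m = \<zero>\<^bsub>M\<^esub> \<Longrightarrow> m \<in> finite_sums M \<Y>"
  using t
proof (induction t arbitrary: thesis rule: finite_sums.induct)
  case zero
  have "(\<lambda>m. m) \<in> Hom R M M" by (simp add: Hom_def)
  then show ?case using zero finite_sums.zero by metis
next
  case (add t Y y)
  obtain e where e: "e \<in> Hom R M M" "e t = \<zero>\<^bsub>M\<^esub>"
    and ker: "\<And>m. m \<in> carrier M \<Longrightarrow> e m = \<zero>\<^bsub>M\<^esub> \<Longrightarrow> m \<in> finite_sums M \<Y>"
    using add.IH by blast
  obtain X g where X: "X \<in> \<X>" and g: "g \<in> Hom R X M" and Y: "Y = g ` carrier X"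
    using \<Y>[OF add.hyps(2)] by (auto simp: brick_image_def)
  obtain x where x: "x \<in> carrier X" "y = g x"
    using add.hyps(3) Y by auto
  have tc: "t \<in> carrier M"
    using finite_sums_submodule[OF left_module_M brick_image_submodule[OF \<Y>]] add.hyps(1)
      submoduleD(1) by blast
  have eg: "(\<lambda>x. e (g x)) \<in> Hom R X M"
    by (rule Hom_compose[OF g e(1)])
  have ety: "e (t \<oplus>\<^bsub>M\<^esub> y) = e y"
    using tc x e Hom_closed[OF g] Hom_closed[OF e(1)] by (simp add: Hom_add[OF e(1)])
  show ?case
  proof (cases "e y = \<zero>\<^bsub>M\<^esub>")
    case True
    then show ?thesis using add.prems e(1) ety ker by simp
  next
    case False
    then obtain r where r: "r \<in> Hom R M X" "\<And>z. z \<in> carrier X \<Longrightarrow> r (e (g z)) = z"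
      using Hom_brick_retraction[OF X eg] x by metis
    have gr: "(\<lambda>m. g (r (e m))) \<in> Hom R M M"
      by (rule Hom_compose[OF Hom_compose[OF e(1) r(1)] g])
    define e' where "e' m = e m \<ominus>\<^bsub>M\<^esub> e (g (r (e m)))" for m
    have e': "e' \<in> Hom R M M"
      unfolding e'_def by (rule Hom_pointwise_diff[OF left_module_M e(1) Hom_compose[OF gr e(1)]])
    show ?thesis
    proof (rule add.prems[OF e'])
      show "e' (t \<oplus>\<^bsub>M\<^esub> y) = \<zero>\<^bsub>M\<^esub>"
        using r(2)[OF x(1)] Hom_closed[OF eg x(1)]
        by (simp add: e'_def ety[unfolded x(2)] x(2) M.minus_eq_zero_iff)
      fix m assume m: "m \<in> carrier M" "e' m = \<zero>\<^bsub>M\<^esub>"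
      define z where "z = g (r (e m))"
      have z: "z \<in> carrier M" "z \<in> Y"
        using Hom_closed[OF gr m(1)] Hom_closed[OF r(1) Hom_closed[OF e(1) m(1)]]
        by (auto simp: z_def Y)
      have "e (m \<ominus>\<^bsub>M\<^esub> z) = \<zero>\<^bsub>M\<^esub>"
        using m(2) Hom_diff[OF left_module_M left_module_M e(1) m(1) z(1)]
        by (simp add: e'_def z_def)
      then have "(m \<ominus>\<^bsub>M\<^esub> z) \<oplus>\<^bsub>M\<^esub> z \<in> finite_sums M \<Y>"
        using ker m(1) z add.hyps(2) by (intro finite_sums.add[of _ _ _ Y]) auto
      then show "m \<in> finite_sums M \<Y>"
        using m(1) z(1) by (simp add: M.minus_add_cancel)
    qed
  qed
qed

lemma brick_image_subset_finite_sums: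
  assumes \<Y>: "\<And>Y. Y \<in> \<Y> \<Longrightarrow> brick_image R \<X> M Y"
    and X: "X \<in> \<X>" and g: "g \<in> Hom R X M"
    and x: "x \<in> carrier X" "g x \<noteq> \<zero>\<^bsub>M\<^esub>" "g x \<in> finite_sums M \<Y>"
  shows "g ` carrier X \<subseteq> finite_sums M \<Y>"
proof -
  obtain e where e: "e \<in> Hom R M M" "e (g x) = \<zero>\<^bsub>M\<^esub>"
    and ker: "\<And>m. m \<in> carrier M \<Longrightarrow> e m = \<zero>\<^bsub>M\<^esub> \<Longrightarrow> m \<in> finite_sums M \<Y>"
    using finite_sums_kernel[OF \<Y> x(3)] by blast
  have "x \<noteq> \<zero>\<^bsub>X\<^esub>"
    using x(2) Hom_zero[OF brick_module[OF X] left_module_M g] by auto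
  then have "e (g y) = \<zero>\<^bsub>M\<^esub>" if "y \<in> carrier X" for y
    using Hom_brick_zero[OF X Hom_compose[OF g e(1)]] x(1) e(2) that by blast
  then show ?thesis
    using ker Hom_closed[OF g] by blast
qed

definition partial_sum :: "'i set \<Rightarrow> 'm set" where
  "partial_sum J = {m \<in> carrier M. \<forall>i\<in>I - J. \<phi> m i = \<zero>\<^bsub>F i\<^esub>}"

lemma partial_sum_submodule: "submodule (partial_sum J) R M"
proof (rule submoduleI)
  show "x \<oplus>\<^bsub>M\<^esub> y \<in> partial_sum J" if "x \<in> partial_sum J" "y \<in> partial_sum J" for x y
    using that by (auto simp: partial_sum_def Hom_add[OF coord_Hom] F_add_zero)
  show "a \<odot>\<^bsub>M\<^esub> x \<in> partial_sum J" if "a \<in> carrier R" "x \<in> partial_sum J" for a x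
    using that by (auto simp: partial_sum_def Hom_smult[OF coord_Hom] F_smult_zero)
qed (auto simp: partial_sum_def coord_zero)

lemma injection_in_partial_sum:
  "i \<in> I \<Longrightarrow> i \<in> J \<Longrightarrow> x \<in> carrier (F i) \<Longrightarrow> injection i x \<in> partial_sum J"
  by (auto simp: partial_sum_def injection_closed coord_injection)

lemma minus_injection_in_partial_sum:
  assumes m: "m \<in> partial_sum (insert i J)" and i: "i \<in> I"
  shows "m \<ominus>\<^bsub>M\<^esub> injection i (\<phi> m i) \<in> partial_sum J"
proof -
  have mc: "m \<in> carrier M" using m by (simp add: partial_sum_def)
  have inj: "injection i (\<phi> m i) \<in> carrier M"
    using Hom_closed[OF coord_Hom mc] i by (simp add: injection_closed)
  have "\<phi> (m \<ominus>\<^bsub>M\<^esub> injection i (\<phi> m i)) j = \<zero>\<^bsub>F j\<^esub>" if j: "j \<in> I - J" for j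
  proof -
    interpret Fj: left_module R "F j"
      using j by (intro brick_module F) auto
    have "\<phi> m j = \<phi> (injection i (\<phi> m i)) j"
      using m i j Hom_closed[OF coord_Hom[OF i] mc] by (auto simp: coord_injection partial_sum_def)
    then show ?thesis
      using j mc inj Hom_closed[OF coord_Hom, of j m] by (simp add: coord_diff Fj.M.minus_eq_zero_iff)
  qed
  then show ?thesis
    using mc inj by (simp add: partial_sum_def)
qed

lemma partial_sum_subset:
  assumes T: "submodule T R M" and inj: "\<And>i. i \<in> J \<inter> I \<Longrightarrow> injection i ` carrier (F i) \<subseteq> T"
  shows "partial_sum J \<subseteq> T"
proof
  note T = submoduleD[OF T]
  have step: "m \<in> T" if "finite A" "A \<subseteq> J \<inter> I" "m \<in> partial_sum A" for A m
    using that
  proof (induction A arbitrary: m rule: finite_induct)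
    case empty
    then have "m = \<zero>\<^bsub>M\<^esub>"
      by (intro coord_eqI) (auto simp: partial_sum_def coord_zero)
    then show ?case using T(2) by simp
  next
    case (insert i A)
    then have i: "i \<in> I" "i \<in> J" and m: "m \<in> carrier M" by (auto simp: partial_sum_def)
    have "m \<ominus>\<^bsub>M\<^esub> injection i (\<phi> m i) \<in> T"
      using insert minus_injection_in_partial_sum[OF insert.prems(2) i(1)] by auto
    moreover have c: "\<phi> m i \<in> carrier (F i)"
      using Hom_closed[OF coord_Hom[OF i(1)] m] .
    then have "injection i (\<phi> m i) \<in> T"
      using inj i by blast
    ultimately have "m \<ominus>\<^bsub>M\<^esub> injection i (\<phi> m i) \<oplus>\<^bsub>M\<^esub> injection i (\<phi> m i) \<in> T"
      by (rule T(3))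
    then show ?case
      using m injection_closed[OF i(1) c] by (simp add: M.minus_add_cancel)
  qed
  fix m assume "m \<in> partial_sum J"
  then show "m \<in> T"
    by (intro step[of "{i \<in> I. \<phi> m i \<noteq> \<zero>\<^bsub>F i\<^esub>}"] finite_support) (auto simp: partial_sum_def)
qed

lemma finite_sums_complement:
  assumes \<Y>: "\<And>Y. Y \<in> \<Y> \<Longrightarrow> brick_image R \<X> M Y"
  obtains J where "J \<subseteq> I" "finite_sums M \<Y> <+>\<^bsub>M\<^esub> partial_sum J = carrier M"
    "finite_sums M \<Y> \<inter> partial_sum J = {\<zero>\<^bsub>M\<^esub>}"
proof -
  define S where "S = finite_sums M \<Y>"
  have S: "submodule S R M"
    unfolding S_def by (rule finite_sums_submodule[OF left_module_M brick_image_submodule[OF \<Y>]])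
  note S' = submoduleD[OF S]
  note P = submoduleD[OF partial_sum_submodule]
  define A where "A = {J. J \<subseteq> I \<and> S \<inter> partial_sum J \<subseteq> {\<zero>\<^bsub>M\<^esub>}}"
  have "\<exists>J\<in>A. \<forall>K\<in>A. J \<subseteq> K \<longrightarrow> K = J"
  proof (rule subset_Zorn_nonempty)
    have "partial_sum {} \<subseteq> {\<zero>\<^bsub>M\<^esub>}"
      using coord_eqI[of _ "\<zero>\<^bsub>M\<^esub>"] by (auto simp: partial_sum_def coord_zero)
    then show "A \<noteq> {}" by (auto simp: A_def)
  next
    fix C assume C: "C \<noteq> {}" "subset.chain A C"
    have "x = \<zero>\<^bsub>M\<^esub>" if x: "x \<in> S" "x \<in> partial_sum (\<Union> C)" for x
    proof -
      have xc: "x \<in> carrier M" using x S'(1) by blast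
      have "{i \<in> I. \<phi> x i \<noteq> \<zero>\<^bsub>F i\<^esub>} \<subseteq> \<Union> C"
        using x by (auto simp: partial_sum_def)
      then obtain J where J: "J \<in> C" "{i \<in> I. \<phi> x i \<noteq> \<zero>\<^bsub>F i\<^esub>} \<subseteq> J"
        using finite_subset_Union_chain[OF finite_support[OF xc]] C by blast
      then have "x \<in> partial_sum J" using xc by (auto simp: partial_sum_def)
      moreover have "J \<in> A" using J C by (auto simp: subset.chain_def)
      ultimately show ?thesis using x by (auto simp: A_def)
    qed
    then show "\<Union> C \<in> A"
      using C by (auto simp: A_def subset.chain_def)
  qed
  then obtain J where J: "J \<subseteq> I" "S \<inter> partial_sum J \<subseteq> {\<zero>\<^bsub>M\<^esub>}"
    and max: "\<And>K. K \<in> A \<Longrightarrow> J \<subseteq> K \<Longrightarrow> K = J"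
    by (auto simp: A_def)
  define \<J> where "\<J> = (\<lambda>i. injection i ` carrier (F i)) ` J"
  define T where "T = finite_sums M (\<Y> \<union> \<J>)"
  have bi: "brick_image R \<X> M Y" if Y: "Y \<in> \<Y> \<union> \<J>" for Y
  proof (cases "Y \<in> \<Y>")
    case False
    then obtain i where "i \<in> J" "Y = injection i ` carrier (F i)"
      using Y by (auto simp: \<J>_def)
    with J(1) show ?thesis
      unfolding brick_image_def using injection_Hom F by blast
  qed (fact \<Y>)
  have T: "submodule T R M"
    unfolding T_def by (rule finite_sums_submodule[OF left_module_M brick_image_submodule[OF bi]])
  note T' = submoduleD[OF T]
  have ST: "S \<subseteq> T"
    unfolding S_def T_def by (intro finite_sums_mono) auto
  have injT: "injection i ` carrier (F i) \<subseteq> T" if i: "i \<in> J" for i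
    unfolding T_def using i J(1)
    by (intro finite_sums_incl[OF left_module_M]) (auto simp: \<J>_def injection_closed subset_iff)
  have PT: "partial_sum J \<subseteq> T"
    by (intro partial_sum_subset[OF T]) (use injT in auto)
  have injT': "injection i ` carrier (F i) \<subseteq> T" if i: "i \<in> I" for i
  proof (cases "i \<in> J")
    case False
    then have "insert i J \<notin> A" using max[of "insert i J"] by auto
    then obtain x where x: "x \<in> S" "x \<in> partial_sum (insert i J)" "x \<noteq> \<zero>\<^bsub>M\<^esub>"
      using J(1) i by (auto simp: A_def)
    have xc: "x \<in> carrier M" using x S'(1) by blast
    have c: "\<phi> x i \<in> carrier (F i)"
      using Hom_closed[OF coord_Hom[OF i] xc] .
    define b where "b = x \<ominus>\<^bsub>M\<^esub> injection i (\<phi> x i)"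
    have b: "b \<in> partial_sum J"
      unfolding b_def by (rule minus_injection_in_partial_sum[OF x(2) i])
    have bc: "b \<in> carrier M" using b P(1) by blast
    have xb: "x \<ominus>\<^bsub>M\<^esub> b = injection i (\<phi> x i)"
    proof -
      have "x = b \<oplus>\<^bsub>M\<^esub> injection i (\<phi> x i)"
        unfolding b_def using xc injection_closed[OF i c] by (simp add: M.minus_add_cancel)
      then show ?thesis
        using bc injection_closed[OF i c] by (metis M.add_minus_cancel M.a_comm)
    qed
    have "x \<noteq> b" using x b J(2) by auto
    then have "injection i (\<phi> x i) \<noteq> \<zero>\<^bsub>M\<^esub>"
      using xb M.minus_eq_zero_iff[OF xc bc] by auto
    moreover have "injection i (\<phi> x i) \<in> T"
      unfolding xb[symmetric] using x b ST PT by (intro T'(5)) auto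
    ultimately show ?thesis
      unfolding T_def
      using brick_image_subset_finite_sums[OF bi F[OF i] injection_Hom[OF i] c] by blast
  qed (use injT in auto)
  have "partial_sum I \<subseteq> T"
    by (intro partial_sum_subset[OF T]) (use injT' in auto)
  then have carrierT: "carrier M \<subseteq> T"
    by (auto simp: partial_sum_def)
  have split: "t \<in> S <+>\<^bsub>M\<^esub> partial_sum J" if "t \<in> T" for t
    using that unfolding T_def
  proof (induction t rule: finite_sums.induct)
    case zero
    show ?case
      using S'(2) P(2)[of J] by (auto simp: set_add_def' intro!: bexI[of _ "\<zero>\<^bsub>M\<^esub>"])
  next
    case (add t Y y)
    from add.IH obtain s p where t: "s \<in> S" "p \<in> partial_sum J" "t = s \<oplus>\<^bsub>M\<^esub> p"
      unfolding set_add_def' by blast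
    have sp: "s \<in> carrier M" "p \<in> carrier M" using t S'(1) P(1)[of J] by auto
    have yc: "y \<in> carrier M"
      using submoduleD(1)[OF brick_image_submodule[OF bi[OF add.hyps(2)]]] add.hyps(3) by auto
    consider "Y \<in> \<Y>" | "Y \<in> \<J>" using add.hyps by blast
    then show ?case
    proof cases
      case 1
      then have "s \<oplus>\<^bsub>M\<^esub> y \<in> S"
        using t add.hyps(3) by (auto simp: S_def intro: finite_sums.add)
      moreover have "t \<oplus>\<^bsub>M\<^esub> y = (s \<oplus>\<^bsub>M\<^esub> y) \<oplus>\<^bsub>M\<^esub> p"
        using t(3) sp yc by (simp add: M.a_ac)
      ultimately show ?thesis using t(2) by (auto simp: set_add_def')
    next
      case 2
      then have "p \<oplus>\<^bsub>M\<^esub> y \<in> partial_sum J"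
        using t(2) add.hyps(3) J(1) P(3) injection_in_partial_sum by (auto simp: \<J>_def)
      moreover have "t \<oplus>\<^bsub>M\<^esub> y = s \<oplus>\<^bsub>M\<^esub> (p \<oplus>\<^bsub>M\<^esub> y)"
        using t(3) sp yc by (simp add: M.a_assoc)
      ultimately show ?thesis using t(1) by (auto simp: set_add_def')
    qed
  qed
  have "S <+>\<^bsub>M\<^esub> partial_sum J = carrier M"
  proof
    show "S <+>\<^bsub>M\<^esub> partial_sum J \<subseteq> carrier M"
      using S'(1) P(1) by (auto simp: set_add_def' subset_iff)
    show "carrier M \<subseteq> S <+>\<^bsub>M\<^esub> partial_sum J"
      using split carrierT by blast
  qed
  moreover have "S \<inter> partial_sum J = {\<zero>\<^bsub>M\<^esub>}"
    using J(2) S'(2) P(2) by blast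
  ultimately show thesis
    using that J(1) unfolding S_def by blast
qed

lemma complement_isomorphic_direct_sum:
  assumes S: "submodule S R M" and J: "J \<subseteq> I"
    and sum: "S <+>\<^bsub>M\<^esub> partial_sum J = carrier M" and int: "S \<inter> partial_sum J = {\<zero>\<^bsub>M\<^esub>}"
  shows "isomorphic R (restrict_module M S) (direct_sum (I - J) F)"
proof -
  note S' = submoduleD[OF S]
  define \<psi> where "\<psi> m = restrict (\<phi> m) (I - J)" for m
  let ?S = "restrict_module M S" and ?D = "direct_sum (I - J) F"
  have carrierS [simp]: "carrier ?S = S" by (simp add: restrict_module_def)
  have Hom: "\<psi> \<in> Hom R ?S ?D"
  proof (rule HomI)
    fix x assume "x \<in> carrier ?S"
    then have x: "x \<in> carrier M" using S'(1) by auto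
    have "{i \<in> I - J. \<psi> x i \<noteq> \<zero>\<^bsub>F i\<^esub>} \<subseteq> {i \<in> I. \<phi> x i \<noteq> \<zero>\<^bsub>F i\<^esub>}"
      by (auto simp: \<psi>_def)
    then have "finite {i \<in> I - J. \<psi> x i \<noteq> \<zero>\<^bsub>F i\<^esub>}"
      using finite_support[OF x] finite_subset by blast
    then show "\<psi> x \<in> carrier ?D"
      using Hom_closed[OF coord_Hom x] by (auto simp: direct_sum_def \<psi>_def)
    show "\<psi> (x \<oplus>\<^bsub>?S\<^esub> y) = \<psi> x \<oplus>\<^bsub>?D\<^esub> \<psi> y" if "y \<in> carrier ?S" for y
    proof -
      have "y \<in> carrier M" using that S'(1) by auto
      with x show ?thesis
        by (auto simp: restrict_module_def direct_sum_def \<psi>_def Hom_add[OF coord_Hom])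
    qed
    show "\<psi> (a \<odot>\<^bsub>?S\<^esub> x) = a \<odot>\<^bsub>?D\<^esub> \<psi> x" if "a \<in> carrier R" for a
      using that x by (auto simp: restrict_module_def direct_sum_def \<psi>_def Hom_smult[OF coord_Hom])
  qed
  have "inj_on \<psi> S"
  proof (rule inj_onI)
    fix x y assume xy: "x \<in> S" "y \<in> S" "\<psi> x = \<psi> y"
    have c: "x \<in> carrier M" "y \<in> carrier M" using xy S'(1) by auto
    have "\<phi> (x \<ominus>\<^bsub>M\<^esub> y) i = \<zero>\<^bsub>F i\<^esub>" if i: "i \<in> I - J" for i
    proof -
      interpret Fi: left_module R "F i"
        using i by (intro brick_module F) auto
      have "\<phi> x i = \<phi> y i"
        using i fun_cong[OF xy(3), of i] by (simp add: \<psi>_def)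
      then show ?thesis
        using i c Hom_closed[OF coord_Hom, of i y] by (simp add: coord_diff Fi.M.minus_eq_zero_iff)
    qed
    then have "x \<ominus>\<^bsub>M\<^esub> y \<in> partial_sum J"
      using c by (simp add: partial_sum_def)
    then have "x \<ominus>\<^bsub>M\<^esub> y = \<zero>\<^bsub>M\<^esub>"
      using int S'(5)[OF xy(1,2)] by blast
    then show "x = y"
      using c by (simp add: M.minus_eq_zero_iff)
  qed
  moreover have "\<psi> ` S = carrier ?D"
  proof
    show "\<psi> ` S \<subseteq> carrier ?D"
      using Hom_closed[OF Hom] by auto
    show "carrier ?D \<subseteq> \<psi> ` S"
    proof
      fix y assume y: "y \<in> carrier ?D"
      define z where "z = (\<lambda>i\<in>I. if i \<in> J then \<zero>\<^bsub>F i\<^esub> else y i)"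
      have "{i \<in> I. z i \<noteq> \<zero>\<^bsub>F i\<^esub>} = {i \<in> I - J. y i \<noteq> \<zero>\<^bsub>F i\<^esub>}"
        by (auto simp: z_def)
      then have "z \<in> carrier (direct_sum I F)"
        using y F_zero_closed by (auto simp: direct_sum_def z_def)
      then obtain m where m: "m \<in> carrier M" "\<phi> m = z"
        unfolding bij_betw_imp_surj_on[OF \<phi>_bij, symmetric] by blast
      then obtain s p where sp: "s \<in> S" "p \<in> partial_sum J" "m = s \<oplus>\<^bsub>M\<^esub> p"
        unfolding sum[symmetric] set_add_def' by blast
      have c: "s \<in> carrier M" "p \<in> carrier M"
        using sp S'(1) by (auto simp: partial_sum_def)
      have "\<psi> s = y"
      proof
        fix i
        show "\<psi> s i = y i"
        proof (cases "i \<in> I - J")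
          case True
          then interpret Fi: left_module R "F i"
            by (intro brick_module F) auto
          have "y i = \<phi> m i" using True m by (simp add: z_def)
          also have "\<dots> = \<phi> s i"
            using True sp c Hom_closed[OF coord_Hom, of i s]
            by (simp add: Hom_add[OF coord_Hom] partial_sum_def)
          finally show ?thesis using True by (simp add: \<psi>_def)
        next
          case False
          then show ?thesis using y by (auto simp: \<psi>_def direct_sum_def PiE_def extensional_def)
        qed
      qed
      with sp(1) show "y \<in> \<psi> ` S" by blast
    qed
  qed
  ultimately have "bij_betw \<psi> (carrier ?S) (carrier ?D)"
    by (simp add: bij_betw_def)
  with Hom show ?thesis
    by (auto simp: isomorphic_def)
qed

end

section \<open>Images of filtered modules\<close>

lemma filtration_induct [consumes 2, case_names zero suc limit]:
  fixes \<mu> :: "'o::wellorder"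
  assumes filt: "filtration R N \<mu> Nc" and "\<nu> \<le> \<mu>"
    and zero: "P {\<zero>\<^bsub>N\<^esub>}"
    and suc: "\<And>\<kappa>. \<kappa> < \<mu> \<Longrightarrow> \<kappa> < ord_suc \<kappa> \<Longrightarrow> ord_suc \<kappa> \<le> \<mu> \<Longrightarrow> P (Nc \<kappa>) \<Longrightarrow> P (Nc (ord_suc \<kappa>))"
    and limit: "\<And>\<nu>. \<nu> \<le> \<mu> \<Longrightarrow> (\<And>\<kappa>. \<kappa> < \<nu> \<Longrightarrow> P (Nc \<kappa>)) \<Longrightarrow> P (\<Union>\<kappa>\<in>{..<\<nu>}. Nc \<kappa>)"
  shows "P (Nc \<nu>)"
  using \<open>\<nu> \<le> \<mu>\<close>
proof (induction \<nu> rule: less_induct)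
  case (less \<nu>)
  consider "\<nu> = ord_zero" | \<kappa> where "\<kappa> < \<nu>" "ord_suc \<kappa> = \<nu>" | "ord_limit \<nu>"
    by (auto simp: ord_limit_def)
  then show ?case
  proof cases
    case 1
    then show ?thesis using filt zero by (simp add: filtration_def)
  next
    case 2
    then show ?thesis using suc[of \<kappa>] less by auto
  next
    case 3
    then show ?thesis using filt limit[of \<nu>] less by (auto simp: filtration_def)
  qed
qed

theorem proposition3p5:
  fixes R :: "('r, 'c) ring_scheme"
    and \<X> :: "('r, 'x) module set"
    and N :: "('r, 'n) module"
    and M :: "('r, 'm) module"
    and \<mu> :: "'o::wellorder"
    and Nc :: "'o \<Rightarrow> 'n set"
    and f :: "'n \<Rightarrow> 'm"
  assumes "ring R"
    and "semibrick R \<X>"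
    and "left_module R N"
    and "X_filtration R \<X> N \<mu> Nc"
    and "left_module R M"
    and "X_semisimple R \<X> M"
    and "f \<in> Hom R N M"
  shows "submodule (f ` carrier N) R M \<and>
         X_semisimple R \<X> (restrict_module M (f ` carrier N)) \<and>
         direct_summand R M (f ` carrier N)"
proof -
  obtain I :: "'m set" and F \<phi> where F: "\<forall>i\<in>I. F i \<in> \<X>" and \<phi>: "\<phi> \<in> Hom R M (direct_sum I F)"
    "bij_betw \<phi> (carrier M) (carrier (direct_sum I F))"
    using \<open>X_semisimple R \<X> M\<close> by (auto simp: X_semisimple_def isomorphic_def)
  interpret semisimple_decomposition R M \<X> I F \<phi>
    using assms F \<phi> by (auto simp: semisimple_decomposition_def semisimple_decomposition_axioms_def)
  let ?H = "f ` carrier N"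
  have filt: "filtration R N \<mu> Nc"
    and factor: "\<And>\<kappa>. \<kappa> < \<mu> \<Longrightarrow> \<exists>X\<in>\<X>.
      isomorphic R (quotient_module (restrict_module N (Nc (ord_suc \<kappa>))) (Nc \<kappa>)) X"
    using \<open>X_filtration R \<X> N \<mu> Nc\<close> by (auto simp: X_filtration_def)
  have H: "submodule ?H R M"
    using assms by (intro Hom_image_submodule)
  note H' = submoduleD[OF H]
  define \<Y> where "\<Y> = {Y. brick_image R \<X> M Y \<and> Y \<subseteq> ?H}"
  define S where "S = finite_sums M \<Y>"
  have \<Y>: "brick_image R \<X> M Y" if "Y \<in> \<Y>" for Y
    using that by (simp add: \<Y>_def)
  have S: "submodule S R M"
    unfolding S_def by (rule finite_sums_submodule[OF left_module_M brick_image_submodule[OF \<Y>]])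
  note S' = submoduleD[OF S]
  have SH: "S \<subseteq> ?H"
  proof
    fix t assume "t \<in> S"
    then show "t \<in> ?H"
      unfolding S_def
      by (induction t rule: finite_sums.induct) (use H' in \<open>auto simp: \<Y>_def\<close>)
  qed
  obtain J where J: "J \<subseteq> I" and sum: "S <+>\<^bsub>M\<^esub> partial_sum J = carrier M"
    and int: "S \<inter> partial_sum J = {\<zero>\<^bsub>M\<^esub>}"
    unfolding S_def using finite_sums_complement[OF \<Y>] by blast
  obtain \<rho> where \<rho>: "\<rho> \<in> Hom R M M" and \<rho>_S: "\<And>x. x \<in> S \<Longrightarrow> \<rho> x = \<zero>\<^bsub>M\<^esub>"
    and \<rho>_diff: "\<And>x. x \<in> carrier M \<Longrightarrow> x \<ominus>\<^bsub>M\<^esub> \<rho> x \<in> S"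
    using complement_projection[OF left_module_M S partial_sum_submodule sum int] by metis
  have f\<rho>: "(\<lambda>n. \<rho> (f n)) \<in> Hom R N M"
    by (rule Hom_compose[OF \<open>f \<in> Hom R N M\<close> \<rho>])
  have idem: "\<rho> (\<rho> x) = \<rho> x" if "x \<in> carrier M" for x
    using that \<rho>_S[OF \<rho>_diff[OF that]] Hom_closed[OF \<rho>]
    by (simp add: Hom_diff[OF left_module_M left_module_M \<rho>] M.minus_eq_zero_iff)
  have \<rho>_H: "\<rho> x \<in> ?H" if "x \<in> ?H" for x
  proof -
    have x: "x \<in> carrier M" using that H'(1) by auto
    have "x \<ominus>\<^bsub>M\<^esub> (x \<ominus>\<^bsub>M\<^esub> \<rho> x) \<in> ?H"
      by (rule H'(5)[OF that subsetD[OF SH \<rho>_diff[OF x]]])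
    moreover have "x \<ominus>\<^bsub>M\<^esub> (x \<ominus>\<^bsub>M\<^esub> \<rho> x) = \<rho> x"
      using x Hom_closed[OF \<rho> x] by (simp add: M.minus_eq M.minus_add M.r_neg2)
    ultimately show ?thesis by simp
  qed
  have "\<forall>n\<in>Nc \<mu>. \<rho> (f n) = \<zero>\<^bsub>M\<^esub>"
    using filt order_refl[of \<mu>]
  proof (induction rule: filtration_induct)
    case zero
    show ?case
      using Hom_zero[OF \<open>left_module R N\<close> left_module_M f\<rho>] by simp
  next
    case (suc \<kappa>)
    have sub: "submodule (Nc \<kappa>) R N" "submodule (Nc (ord_suc \<kappa>)) R N" "Nc \<kappa> \<subseteq> Nc (ord_suc \<kappa>)"
      using filt suc by (auto simp: filtration_def)
    obtain X where X: "X \<in> \<X>"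
      "isomorphic R (quotient_module (restrict_module N (Nc (ord_suc \<kappa>))) (Nc \<kappa>)) X"
      using factor suc by blast
    obtain h where h: "h \<in> Hom R X M" "h ` carrier X = (\<lambda>n. \<rho> (f n)) ` Nc (ord_suc \<kappa>)"
      using factor_through_quotient[OF \<open>left_module R N\<close> left_module_M sub(2,1,3) X(2) f\<rho>] suc.IH
      by blast
    have NN: "Nc (ord_suc \<kappa>) \<subseteq> carrier N"
      using left_module.submoduleD(1)[OF \<open>left_module R N\<close> sub(2)] .
    have "h ` carrier X \<subseteq> ?H"
      unfolding h(2) using NN \<rho>_H by blast
    then have "h ` carrier X \<in> \<Y>"
      using X(1) h(1) by (auto simp: \<Y>_def brick_image_def)
    then have "h ` carrier X \<subseteq> S"
      unfolding S_def using Hom_closed[OF h(1)] by (intro finite_sums_incl[OF left_module_M]) auto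
    then have "\<rho> (f n) \<in> S" if "n \<in> Nc (ord_suc \<kappa>)" for n
      using that h(2) by blast
    then have "\<rho> (\<rho> (f n)) = \<zero>\<^bsub>M\<^esub>" if "n \<in> Nc (ord_suc \<kappa>)" for n
      using that \<rho>_S by blast
    then show ?case
      using NN idem Hom_closed[OF \<open>f \<in> Hom R N M\<close>] by (metis subsetD)
  next
    case (limit \<nu>)
    then show ?case by blast
  qed
  then have kill: "\<rho> (f n) = \<zero>\<^bsub>M\<^esub>" if "n \<in> carrier N" for n
    using filt that by (simp add: filtration_def)
  have "?H \<subseteq> S"
  proof
    fix x assume "x \<in> ?H"
    then have x: "x \<in> carrier M" "\<rho> x = \<zero>\<^bsub>M\<^esub>" using H'(1) kill by auto
    then show "x \<in> S"
      using \<rho>_diff[OF x(1)] M.add_minus_cancel[OF x(1) M.zero_closed] by simp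
  qed
  with SH have HS: "?H = S" by blast
  have "X_semisimple R \<X> (restrict_module M S)"
    unfolding X_semisimple_def
    using complement_isomorphic_direct_sum[OF S J sum int] F by blast
  moreover have "direct_summand R M S"
    unfolding direct_summand_def using S sum int partial_sum_submodule by blast
  ultimately show ?thesis
    using H HS by simp
qed

end
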